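(* Let $N,K,L$ be positive integers with $L\le K$, and consider the $(N,K,L)$-CCDN. Let $R^*(M)$ be its optimal transmission rate under the restriction of uncoded placement at cache size $M$. For every $w\in\{1,\dots,\lfloor K/L\rfloor\}$, at the memory point $M=wN/K$, $$R^*(M)\le R_{\text{new}}(M):=\frac{\sum_{\mathbf b\in\mathcal B}\min\{2(K-wL)+w-1-\widehat{\mathbf b},\;K\}}{|\hat{\mathcal S}|\,(w+1)},$$ where $\mathcal B$ is the set of all weak $(w+1)$-compositions of $K-wL-1$, $\widehat{\mathbf b}$ is the maximum component of $\mathbf b$, and $\hat{\mathcal S}$ is the collection of all subsets $s\subseteq\{1,\dots,K\}$ with $|s|=w$ such that (if $w>1$) any two distinct $a,a'\in s$ satisfy $|a-a'|\ge L$ and $K-|a-a'|\ge L$.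
   Context: The $(N,K,L)$-CCDN (multi-access coded caching problem): a central server holds $N$ files, each of size 1 unit ($F$ bits, $F$ sufficiently large; arbitrary $F$-bit strings). There are $K$ caches, each of size $M$ units, and $K$ users; user $k$ has access to the $L$ consecutive caches $k,k+1,\dots,k+L-1$ (indices cyclically modulo $K$). In the placement phase the caches are filled without knowledge of the requests; placement is uncoded if each file may be split into parts and each cache stores some individual parts, with no coding across parts. In the delivery phase each user $k$ requests one file $d_k\in\{1,\dots,N\}$, and the server, knowing all requests, broadcasts an error-free message to all users; each user must recover its requested file from this message and the content of the $L$ caches it accesses. $R^*(M)$ is the minimum (infimum), over all uncoded placements and all delivery schemes, of the worst-case (over request patterns) size, in units, of the server message. A weak $m$-composition of an integer $n$ is a vector $(b_m,\dots,b_1)$ of $m$ non-negative integers with sum $n$ (there are none if $n<0$). The cardinality of $\hat{\mathcal S}$ is $|\hat{\mathcal S}|=\frac{K}{w}\binom{K-wL+w-1}{w-1}$. *)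

theory Defs
  imports Complex_Main "HOL-Library.FuncSet"
begin

section \<open>The multi-access coded caching network\<close>

text \<open>Files, caches and users are numbered from 1. With file size \<open>F\<close> bits, a library is a
  tuple of \<open>N\<close> bit strings of length \<open>F\<close>, and \<open>(n, i)\<close> denotes bit \<open>i < F\<close> of file \<open>n\<close>.\<close>

definition libraries :: "nat \<Rightarrow> nat \<Rightarrow> (nat \<Rightarrow> bool list) set" where
  "libraries N F = {1..N} \<rightarrow>\<^sub>E {x. length x = F}"

definition requests :: "nat \<Rightarrow> nat \<Rightarrow> (nat \<Rightarrow> nat) set" where
  "requests N K = {1..K} \<rightarrow>\<^sub>E {1..N}"

text \<open>The caches \<open>k, k + 1, \<dots>, k + L - 1\<close>, reduced cyclically into \<open>{1..K}\<close>.\<close>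

definition accessed :: "nat \<Rightarrow> nat \<Rightarrow> nat \<Rightarrow> nat set" where
  "accessed K L k = (\<lambda>j. (k - 1 + j) mod K + 1) ` {..<L}"

text \<open>An uncoded placement lets cache \<open>k\<close> store verbatim the bits in \<open>Z k\<close>: the parts into which
  the files are split are arbitrary sets of bits. The capacity of a cache is \<open>M\<close> units, that is
  \<open>M * F\<close> bits, and \<open>Z\<close> may depend neither on the file contents nor on the requests.\<close>

definition uncoded_placement ::
    "nat \<Rightarrow> nat \<Rightarrow> real \<Rightarrow> nat \<Rightarrow> (nat \<Rightarrow> (nat \<times> nat) set) \<Rightarrow> bool" where
  "uncoded_placement N K M F Z \<longleftrightarrow>
     (\<forall>k\<in>{1..K}. Z k \<subseteq> {1..N} \<times> {..<F} \<and> real (card (Z k)) \<le> M * real F)"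

definition cache_content :: "(nat \<times> nat) set \<Rightarrow> (nat \<Rightarrow> bool list) \<Rightarrow> nat \<times> nat \<Rightarrow> bool" where
  "cache_content A W = (\<lambda>(n, i)\<in>A. W n ! i)"

text \<open>For the request pattern \<open>d\<close> the server broadcasts the \<open>len d\<close> bits \<open>enc d W\<close>, where \<open>W\<close> is
  the library; \<open>dec d k\<close> is the decoder of user \<open>k\<close>. As usual, all users know the request
  pattern. Decoding is error-free for every library.\<close>

definition delivery_scheme ::
    "nat \<Rightarrow> nat \<Rightarrow> nat \<Rightarrow> nat \<Rightarrow> (nat \<Rightarrow> (nat \<times> nat) set) \<Rightarrow>
     ((nat \<Rightarrow> nat) \<Rightarrow> nat) \<Rightarrow>
     ((nat \<Rightarrow> nat) \<Rightarrow> (nat \<Rightarrow> bool list) \<Rightarrow> bool list) \<Rightarrow>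
     ((nat \<Rightarrow> nat) \<Rightarrow> nat \<Rightarrow> bool list \<Rightarrow> (nat \<Rightarrow> nat \<times> nat \<Rightarrow> bool) \<Rightarrow> bool list) \<Rightarrow> bool" where
  "delivery_scheme N K L F Z len enc dec \<longleftrightarrow>
     (\<forall>d\<in>requests N K. \<forall>W\<in>libraries N F.
        length (enc d W) = len d \<and>
        (\<forall>k\<in>{1..K}. dec d k (enc d W) (\<lambda>j\<in>accessed K L k. cache_content (Z j) W) = W (d k)))"

definition worst_case_rate :: "nat \<Rightarrow> nat \<Rightarrow> nat \<Rightarrow> ((nat \<Rightarrow> nat) \<Rightarrow> nat) \<Rightarrow> real" where
  "worst_case_rate N K F len = Max ((\<lambda>d. real (len d) / real F) ` requests N K)"

text \<open>A rate counts as achievable if it is attained for all sufficiently large file sizes; the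
  scheme may depend on \<open>F\<close>.\<close>

definition achievable :: "nat \<Rightarrow> nat \<Rightarrow> nat \<Rightarrow> real \<Rightarrow> real \<Rightarrow> bool" where
  "achievable N K L M R \<longleftrightarrow>
     (\<exists>F0>0. \<forall>F\<ge>F0. \<exists>Z len enc dec.
        uncoded_placement N K M F Z \<and> delivery_scheme N K L F Z len enc dec \<and>
        worst_case_rate N K F len \<le> R)"

definition opt_rate :: "nat \<Rightarrow> nat \<Rightarrow> nat \<Rightarrow> real \<Rightarrow> real" where
  "opt_rate N K L M = Inf {R. achievable N K L M R}"

text \<open>The infimum is taken over a nonempty set that is bounded below, so it is a genuine one.\<close>

lemma finite_requests: "finite (requests N K)"
  by (simp add: requests_def finite_PiE)

lemma requests_nonempty: "N > 0 \<Longrightarrow> requests N K \<noteq> {}"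
  by (auto simp: requests_def PiE_eq_empty_iff)

lemma achievable_nonneg:
  assumes "N > 0" "achievable N K L M R"
  shows "R \<ge> 0"
proof -
  obtain F len where le: "worst_case_rate N K F len \<le> R"
    using assms(2) unfolding achievable_def by blast
  obtain d where d: "d \<in> requests N K"
    using requests_nonempty[OF assms(1)] by blast
  have "0 \<le> real (len d) / real F"
    by simp
  also have "\<dots> \<le> worst_case_rate N K F len"
    unfolding worst_case_rate_def by (rule Max_ge) (use d finite_requests in auto)
  finally show ?thesis
    using le by simp
qed

lemma bdd_below_achievable: "N > 0 \<Longrightarrow> bdd_below {R. achievable N K L M R}"
  using achievable_nonneg by (intro bdd_belowI[of _ 0]) auto

lemma achievable_broadcast_all:
  assumes "N > 0" "M \<ge> 0"
  shows "achievable N K L M (real N)"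
proof -
  define enc where "enc = (\<lambda>(d :: nat \<Rightarrow> nat) (W :: nat \<Rightarrow> bool list). concat (map W [1..<N+1]))"
  have len: "length (enc d W) = N * F" if "W \<in> libraries N F" for d W F
  proof -
    have "length (enc d W) = (\<Sum>n\<leftarrow>[1..<N+1]. length (W n))"
      by (simp add: enc_def length_concat comp_def del: upt_Suc)
    also have "\<dots> = (\<Sum>n\<leftarrow>[1..<N+1]. F)"
      by (intro arg_cong[where f = sum_list] map_cong)
        (use that in \<open>auto simp: libraries_def PiE_iff\<close>)
    finally show ?thesis
      by (simp add: sum_list_triv del: upt_Suc)
  qed
  have inj: "W = W'" if "W \<in> libraries N F" "W' \<in> libraries N F" "enc d W = enc d W'" for d W W' F
  proof -
    have "map W [1..<N+1] = map W' [1..<N+1]"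
      using that by (intro concat_injective)
        (auto simp: enc_def libraries_def PiE_iff set_zip simp del: upt_Suc)
    then have "W n = W' n" if "n \<in> {1..N}" for n
      using that by (auto simp del: upt_Suc)
    then show ?thesis
      using that(1,2) unfolding libraries_def by (intro PiE_ext)
  qed
  have "\<exists>Z len enc dec. uncoded_placement N K M F Z \<and> delivery_scheme N K L F Z len enc dec \<and>
        worst_case_rate N K F len \<le> real N" if "F \<ge> 1" for F
  proof (intro exI conjI)
    show "uncoded_placement N K M F (\<lambda>_. {})"
      using assms by (simp add: uncoded_placement_def)
    show "delivery_scheme N K L F (\<lambda>_. {}) (\<lambda>_. N * F) enc
        (\<lambda>d k x _. (THE W. W \<in> libraries N F \<and> enc d W = x) (d k))"
      unfolding delivery_scheme_def
    proof (intro ballI conjI)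
      fix d W k assume W: "W \<in> libraries N F"
      show "length (enc d W) = N * F"
        using W by (rule len)
      have "(THE W'. W' \<in> libraries N F \<and> enc d W' = enc d W) = W"
        using W inj by (intro the_equality) auto
      then show "(THE W'. W' \<in> libraries N F \<and> enc d W' = enc d W) (d k) = W (d k)"
        by simp
    qed
    show "worst_case_rate N K F (\<lambda>_. N * F) \<le> real N"
      using that requests_nonempty[OF assms(1), of K]
      by (simp add: worst_case_rate_def image_constant_conv)
  qed
  then show ?thesis
    unfolding achievable_def by (intro exI[of _ 1]) simp
qed


section \<open>The rate of the new scheme\<close>

definition weak_compositions :: "nat \<Rightarrow> int \<Rightarrow> nat list set" where
  "weak_compositions m n = {b. length b = m \<and> int (sum_list b) = n}"

lemma finite_weak_compositions: "finite (weak_compositions m n)"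
proof (rule finite_subset)
  show "weak_compositions m n \<subseteq> {b. set b \<subseteq> {..nat n} \<and> length b = m}"
    by (auto simp: weak_compositions_def dest: member_le_sum_list)
  show "finite {b. set b \<subseteq> {..nat n} \<and> length b = m}"
    by (rule finite_lists_length_eq) simp
qed

definition spread_subsets :: "nat \<Rightarrow> nat \<Rightarrow> nat \<Rightarrow> nat set set" where
  "spread_subsets K L w = {s. s \<subseteq> {1..K} \<and> card s = w \<and>
     (\<forall>a\<in>s. \<forall>a'\<in>s. a \<noteq> a' \<longrightarrow>
        int L \<le> \<bar>int a - int a'\<bar> \<and> int L \<le> int K - \<bar>int a - int a'\<bar>)}"

definition R_new :: "nat \<Rightarrow> nat \<Rightarrow> nat \<Rightarrow> real" where
  "R_new K L w =
     (\<Sum>b\<in>weak_compositions (w + 1) (int K - int w * int L - 1).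
        min (2 * (real K - real w * real L) + real w - 1 - real (Max (set b))) (real K))
     / (real (card (spread_subsets K L w)) * (real w + 1))"

end

theory Submission
  imports Defs
begin

text \<open>Split every file into one part for each \<open>s\<close> in \<open>spread_subsets K L w\<close>
  and each \<open>r \<le> w\<close>; cache \<open>k\<close> stores the parts with \<open>k \<in> s\<close>. A pair of a user \<open>k\<close> and a set
  \<open>s\<close> that misses the caches of \<open>k\<close> is described by \<open>k\<close> and the composition of \<open>K - wL - 1\<close>
  formed by the gaps between \<open>k\<close> and the blocks of length \<open>L\<close> around the cycle.
  Fix a composition \<open>b\<close> and a node \<open>v\<close>, and walk around the cycle from \<open>v\<close>: this visits users
  \<open>k\<^sub>0, \<dots>, k\<^sub>w\<close>, where \<open>k\<^sub>i\<close> lacks the set belonging to \<open>k\<^sub>i\<close> and the \<open>i\<close>-th rotation of \<open>b\<close>, while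
  every other \<open>k\<^sub>j\<close> knows it. So the sum \<open>Y\<^sub>v\<close> of the \<open>w + 1\<close> parts concerned serves all \<open>w + 1\<close> users.
  If \<open>b\<close> is first rotated to have its maximum last, then each user already knows all but
  \<open>2(K - wL) + w - 1 - max b\<close> of the \<open>K\<close> symbols \<open>Y\<^sub>v\<close>, so that an MDS code, or here a colouring of the
  confusion graph, needs only the smaller of this number and \<open>K\<close> symbols. Rounding the file size and
  colouring cost a bounded number of bits, which the infimum over achievable rates absorbs.\<close>

section \<open>Delivering parities by colouring\<close>

text \<open>Vertices are coloured one at a time: a new vertex has fewer than \<open>card C\<close>
  neighbours, which cannot block every colour. Degrees only shrink when the graph is restricted, so
  the induction hypothesis applies.\<close>

lemma greedy_coloring:
  assumes "finite V" and sym: "\<And>x y. R x y \<Longrightarrow> R y x"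
    and deg: "\<And>x. x \<in> V \<Longrightarrow> card {y \<in> V. y \<noteq> x \<and> R x y} < card C"
  shows "\<exists>c. c ` V \<subseteq> C \<and> (\<forall>x\<in>V. \<forall>y\<in>V. R x y \<longrightarrow> c x = c y \<longrightarrow> x = y)"
  using assms(1) deg
proof (induction V)
  case empty
  then show ?case by simp
next
  case (insert a V)
  have "card {y \<in> V. y \<noteq> x \<and> R x y} < card C" if "x \<in> V" for x
  proof -
    have "card {y \<in> V. y \<noteq> x \<and> R x y} \<le> card {y \<in> insert a V. y \<noteq> x \<and> R x y}"
      using insert.hyps by (intro card_mono) auto
    then show ?thesis using insert.prems[of x] that by simp
  qed
  then obtain c where c: "c ` V \<subseteq> C" "\<forall>x\<in>V. \<forall>y\<in>V. R x y \<longrightarrow> c x = c y \<longrightarrow> x = y"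
    using insert.IH by blast
  let ?nb = "{y \<in> insert a V. y \<noteq> a \<and> R a y}"
  have "card (c ` ?nb) \<le> card ?nb"
    using insert.hyps by (intro card_image_le) simp
  also have "\<dots> < card C"
    using insert.prems by simp
  finally have "\<not> C \<subseteq> c ` ?nb"
    using card_mono[of "c ` ?nb" C] insert.hyps by auto
  then obtain z where z: "z \<in> C" "z \<notin> c ` ?nb" by blast
  let ?c = "c(a := z)"
  have "?c ` insert a V \<subseteq> C"
    using c(1) z(1) by auto
  moreover have "x = y" if "x \<in> insert a V" "y \<in> insert a V" "R x y" "?c x = ?c y" for x y
    using that c(2) z(2) sym[OF that(3)] by (auto split: if_splits)
  ultimately show ?case by blast
qed

text \<open>This is XOR decoding: once all other terms of a sum modulo 2 are known, its value
  determines the one remaining bit.\<close>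

lemma eq_if_same_parity:
  assumes "finite X" "p \<in> X" and same: "\<And>q. q \<in> X - {p} \<Longrightarrow> P q = Q q"
    and parity: "odd (card {q \<in> X. P q}) \<longleftrightarrow> odd (card {q \<in> X. Q q})"
  shows "P p = Q p"
proof -
  have split: "card {q \<in> X. T q} = card {q \<in> X - {p}. T q} + (if T p then 1 else 0)" for T
  proof -
    have "{q \<in> X. T q} = {q \<in> X - {p}. T q} \<union> (if T p then {p} else {})"
      using assms(2) by auto
    then show ?thesis
      using assms(1) by (auto simp: card_insert_if)
  qed
  have "{q \<in> X - {p}. P q} = {q \<in> X - {p}. Q q}"
    using same by blast
  then show ?thesis
    using parity split[of P] split[of Q] by (auto split: if_splits)
qed

text \<open>The server forms the parities of the sets in \<open>A d\<close>. User \<open>k\<close> knows all but \<open>m\<close> of them, and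
  rather than sending \<open>m\<close> symbols of an MDS code it suffices to send a colour of the parity vector,
  where vectors that some user cannot tell apart get different colours. Greedy colouring costs only
  \<open>K\<close> bits more than an MDS code would.\<close>

lemma delivery_scheme_parities:
  fixes K L :: nat and Z :: "nat \<Rightarrow> (nat \<times> nat) set" and A :: "(nat \<Rightarrow> nat) \<Rightarrow> (nat \<times> nat) set set"
  defines "C \<equiv> \<lambda>k. \<Union> (Z ` accessed K L k)"
  assumes fin: "\<And>d. d \<in> requests N K \<Longrightarrow> finite (A d)"
    and fin_mem: "\<And>d X. d \<in> requests N K \<Longrightarrow> X \<in> A d \<Longrightarrow> finite X"
    and unknown: "\<And>d k. d \<in> requests N K \<Longrightarrow> k \<in> {1..K} \<Longrightarrow> card {X \<in> A d. \<not> X \<subseteq> C k} \<le> m"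
    and decodable: "\<And>d k i. d \<in> requests N K \<Longrightarrow> k \<in> {1..K} \<Longrightarrow> i < F \<Longrightarrow> (d k, i) \<notin> C k \<Longrightarrow>
      \<exists>X\<in>A d. (d k, i) \<in> X \<and> X - {(d k, i)} \<subseteq> C k"
  shows "\<exists>enc dec. delivery_scheme N K L F Z (\<lambda>_. m + K) enc dec"
proof -
  define y where "y = (\<lambda>d W. {X \<in> A d. odd (card {(n, i) \<in> X. W n ! i})})"
  define code where "code = {x :: bool list. length x = m + K}"
  have card_code: "card code = 2 ^ (m + K)"
    using card_lists_length_eq[of "UNIV :: bool set" "m + K"] by (simp add: code_def)
  \<comment> \<open>A parity vector is encoded as the set of those members of \<open>A d\<close>
    whose parity is odd. Two vectors are adjacent when they differ only in parities unknown to one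
    and the same user.\<close>
  define proper where "proper = (\<lambda>d c. c ` Pow (A d) \<subseteq> code \<and> (\<forall>a\<in>Pow (A d). \<forall>a'\<in>Pow (A d).
      (\<exists>k\<in>{1..K}. sym_diff a a' \<subseteq> {X \<in> A d. \<not> X \<subseteq> C k}) \<longrightarrow> c a = c a' \<longrightarrow> a = a'))"
  have "\<exists>c. proper d c" if d: "d \<in> requests N K" for d
    unfolding proper_def
  proof (rule greedy_coloring)
    let ?U = "\<lambda>k. {X \<in> A d. \<not> X \<subseteq> C k}"
    let ?R = "\<lambda>a a'. \<exists>k\<in>{1..K}. sym_diff a a' \<subseteq> ?U k"
    show "finite (Pow (A d))"
      using fin[OF d] by simp
    show "?R a' a" if "?R a a'" for a a'
      using that by (simp add: Un_commute)
    show "card {a' \<in> Pow (A d). a' \<noteq> a \<and> ?R a a'} < card code" if a: "a \<in> Pow (A d)" for a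
    proof -
      have finU: "finite (?U k)" for k
        using fin[OF d] by simp
      \<comment> \<open>For each user, the vectors confusable with \<open>a\<close> arise by
        flipping some of at most \<open>m\<close> coordinates. This gives at most
        \<open>K * 2 ^ m\<close> neighbours, fewer than the \<open>2 ^ (m + K)\<close>
        codewords.\<close>
      have "{a' \<in> Pow (A d). a' \<noteq> a \<and> ?R a a'} \<subseteq> (\<Union>k\<in>{1..K}. sym_diff a ` Pow (?U k))"
      proof
        fix a' assume "a' \<in> {a' \<in> Pow (A d). a' \<noteq> a \<and> ?R a a'}"
        then obtain k where k: "k \<in> {1..K}" "sym_diff a a' \<subseteq> ?U k" by blast
        have "a' = sym_diff a (sym_diff a a')" by blast
        then show "a' \<in> (\<Union>k\<in>{1..K}. sym_diff a ` Pow (?U k))"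
          using k by blast
      qed
      then have "card {a' \<in> Pow (A d). a' \<noteq> a \<and> ?R a a'} \<le> card (\<Union>k\<in>{1..K}. sym_diff a ` Pow (?U k))"
        using finU by (intro card_mono finite_UN_I finite_imageI) auto
      also have "\<dots> \<le> (\<Sum>k\<in>{1..K}. card (sym_diff a ` Pow (?U k)))"
        by (rule card_UN_le) simp
      also have "\<dots> \<le> (\<Sum>k\<in>{1..K}. 2 ^ m)"
      proof (rule sum_mono)
        fix k assume k: "k \<in> {1..K}"
        have "card (sym_diff a ` Pow (?U k)) \<le> card (Pow (?U k))"
          using finU by (intro card_image_le) simp
        also have "\<dots> \<le> 2 ^ m"
          using unknown[OF d k] finU by (simp add: card_Pow)
        finally show "card (sym_diff a ` Pow (?U k)) \<le> 2 ^ m" .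
      qed
      also have "\<dots> < card code"
        using less_exp[of K] by (simp add: card_code power_add)
      finally show ?thesis .
    qed
  qed
  then obtain c where c: "proper d (c d)" if "d \<in> requests N K" for d
    by metis
  define enc where "enc = (\<lambda>d W. c d (y d W))"
  define view where "view = (\<lambda>k W. \<lambda>j\<in>accessed K L k. cache_content (Z j) W)"
  \<comment> \<open>Any library consistent with the broadcast and the caches will do, since
    \<open>separates\<close> shows that all of them agree on the requested file.\<close>
  define dec where "dec = (\<lambda>d k x g. (SOME W. W \<in> libraries N F \<and> enc d W = x \<and> view k W = g) (d k))"
  have y_Pow: "y d W \<in> Pow (A d)" for d W
    by (auto simp: y_def)
  have separates: "W (d k) = W' (d k)"
    if d: "d \<in> requests N K" and W: "W \<in> libraries N F" "W' \<in> libraries N F" and k: "k \<in> {1..K}"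
      and enc: "enc d W = enc d W'" and view: "view k W = view k W'" for d W W' k
  proof -
    have known: "W n ! i = W' n ! i" if ni: "(n, i) \<in> C k" for n i
    proof -
      obtain j where j: "j \<in> accessed K L k" "(n, i) \<in> Z j"
        using ni by (auto simp: C_def)
      have "cache_content (Z j) W (n, i) = cache_content (Z j) W' (n, i)"
        using fun_cong[OF view, of j] j(1) by (simp add: view_def)
      then show ?thesis
        using j(2) by (simp add: cache_content_def)
    qed
    have "{(n, i) \<in> X. W n ! i} = {(n, i) \<in> X. W' n ! i}" if "X \<subseteq> C k" for X
      using known that by blast
    then have "sym_diff (y d W) (y d W') \<subseteq> {X \<in> A d. \<not> X \<subseteq> C k}"
      by (auto simp: y_def)
    then have y_eq: "y d W = y d W'"
      using c[OF d] y_Pow[of d W] y_Pow[of d W'] k enc unfolding proper_def enc_def by meson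
    have "d k \<in> {1..N}"
      using d k by (auto simp: requests_def)
    then have len: "length (W (d k)) = F" "length (W' (d k)) = F"
      using W by (auto simp: libraries_def PiE_iff)
    have "W (d k) ! i = W' (d k) ! i" if i: "i < F" for i
    proof (cases "(d k, i) \<in> C k")
      case True
      then show ?thesis by (rule known)
    next
      case False
      then obtain X where X: "X \<in> A d" "(d k, i) \<in> X" "X - {(d k, i)} \<subseteq> C k"
        using decodable[OF d k i] by blast
      have "odd (card {(n, i) \<in> X. W n ! i}) \<longleftrightarrow> odd (card {(n, i) \<in> X. W' n ! i})"
        using y_eq X(1) by (auto simp: y_def)
      moreover have "{(n, i) \<in> X. T n i} = {q \<in> X. T (fst q) (snd q)}" for T
        by auto
      ultimately have parity: "odd (card {q \<in> X. W (fst q) ! snd q}) \<longleftrightarrow> odd (card {q \<in> X. W' (fst q) ! snd q})"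
        by simp
      have "W (fst q) ! snd q = W' (fst q) ! snd q" if "q \<in> X - {(d k, i)}" for q
        using known[of "fst q" "snd q"] X(3) that by auto
      from eq_if_same_parity[OF fin_mem[OF d X(1)] X(2) this parity] show ?thesis
        by simp
    qed
    then show ?thesis
      using len by (simp add: list_eq_iff_nth_eq)
  qed
  have "delivery_scheme N K L F Z (\<lambda>_. m + K) enc dec"
    unfolding delivery_scheme_def
  proof (intro ballI conjI)
    fix d W assume d: "d \<in> requests N K" and W: "W \<in> libraries N F"
    show "length (enc d W) = m + K"
      using c[OF d] y_Pow[of d W] by (auto simp: proper_def enc_def code_def)
    fix k assume k: "k \<in> {1..K}"
    define W0 where "W0 = (SOME W'. W' \<in> libraries N F \<and> enc d W' = enc d W \<and> view k W' = view k W)"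
    have "W0 \<in> libraries N F \<and> enc d W0 = enc d W \<and> view k W0 = view k W"
      unfolding W0_def by (rule someI[of _ W]) (simp add: W)
    then have "W0 (d k) = W (d k)"
      using separates[OF d _ W k, of W0] by simp
    then show "dec d k (enc d W) (\<lambda>j\<in>accessed K L k. cache_content (Z j) W) = W (d k)"
      by (simp add: dec_def W0_def view_def)
  qed
  then show ?thesis by blast
qed

section \<open>Walking around the cycle\<close>

text \<open>Nodes of the cycle are addressed by arbitrary natural numbers, so that all arguments can walk
  forward around the cycle. If the gaps between consecutive length-\<open>L\<close> blocks are given by \<open>b\<close>,
  the \<open>t\<close>-th block after the starting node ends up at distance \<open>offset L b t\<close>.\<close>

definition node :: "nat \<Rightarrow> nat \<Rightarrow> nat" where
  "node K x = x mod K + 1"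

definition offset :: "nat \<Rightarrow> nat list \<Rightarrow> nat \<Rightarrow> nat" where
  "offset L b t = t * L + sum_list (take t b)"

text \<open>Index 0 is omitted because it is the user's own position. The final entry of
  \<open>b\<close> is the gap that leads back to the start.\<close>

definition gap_set :: "nat \<Rightarrow> nat \<Rightarrow> nat \<Rightarrow> nat list \<Rightarrow> nat set" where
  "gap_set K L x b = (\<lambda>t. node K (x + offset L b t)) ` {1..<length b}"

lemma node_mod: "node K (x mod K + j) = node K (x + j)"
  by (simp add: node_def mod_simps)

lemma node_add_self: "node K (x + K) = node K x"
  by (simp add: node_def)

lemma accessed_node: "accessed K L (node K x) = (\<lambda>j. node K (x + j)) ` {..<L}"
  by (simp add: accessed_def node_def mod_simps)

lemma node_in_accessed: "y \<le> z \<Longrightarrow> z < y + L \<Longrightarrow> node K z \<in> accessed K L (node K y)"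
  unfolding accessed_node by (intro image_eqI[where x = "z - y"]) auto

lemma offset_Suc: "t < length b \<Longrightarrow> offset L b (Suc t) = offset L b t + L + b ! t"
  by (simp add: offset_def take_Suc_conv_app_nth)

text \<open>After moving to position \<open>i\<close>, the first \<open>j - i\<close> gaps of the
  rotated list are exactly those that \<open>b\<close> has between \<open>i\<close> and
  \<open>j\<close>, so the distances add up.\<close>

lemma gap_set_rotate_later:
  assumes "i < j" "j < length b"
  shows "node K (v + offset L b j) \<in> gap_set K L (v + offset L b i) (rotate i b)"
proof -
  have "sum_list (take (j - i) (rotate i b)) = sum_list (take (j - i) (drop i b))"
    using assms by (simp add: rotate_drop_take)
  moreover have "sum_list (take i b) + sum_list (take (j - i) (drop i b)) = sum_list (take j b)"
    using assms take_add[of i "j - i" b] by simp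
  moreover have "i * L + (j - i) * L = j * L"
    using assms by (simp flip: add_mult_distrib)
  ultimately have "v + offset L b i + offset L (rotate i b) (j - i) = v + offset L b j"
    unfolding offset_def by linarith
  then show ?thesis
    unfolding gap_set_def using assms by (intro image_eqI[where x = "j - i"]) (auto simp: add.assoc)
qed

text \<open>Walking once around the cycle overshoots the starting node by \<open>L - 1\<close>.\<close>

lemma gap_set_rotate_earlier:
  assumes "j < i" "i < length b" and total: "offset L b (length b) = K + (L - 1)"
  shows "node K (v + offset L b j + (L - 1)) \<in> gap_set K L (v + offset L b i) (rotate i b)"
proof -
  define t where "t = length b - i + j"
  have "take t (rotate i b) = drop i b @ take j b"
    using assms by (simp add: rotate_drop_take t_def min_def)
  moreover have "sum_list (take i b) + sum_list (drop i b) = sum_list b"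
    by (metis append_take_drop_id sum_list_append)
  moreover have "i * L + t * L = length b * L + j * L"
    using assms by (simp add: t_def flip: add_mult_distrib)
  ultimately have "v + offset L b i + offset L (rotate i b) t = v + offset L b j + offset L b (length b)"
    unfolding offset_def by simp
  also have "\<dots> = (v + offset L b j + (L - 1)) + K"
    by (simp add: total)
  finally have "node K (v + offset L b i + offset L (rotate i b) t) = node K (v + offset L b j + (L - 1))"
    by (simp only: node_add_self)
  then show ?thesis
    unfolding gap_set_def using assms
    by (intro image_eqI[where x = t]) (auto simp: t_def)
qed

text \<open>A later receiver finds its own first cache in the set, an earlier one its last cache,
  because of the overshoot. Hence in a sum of \<open>w + 1\<close> parts every receiver can cancel
  all terms but its own.\<close>

lemma receiver_knows_others:
  assumes "i < length b" "j < length b" "i \<noteq> j" "L > 0" "offset L b (length b) = K + (L - 1)"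
  shows "gap_set K L (v + offset L b i) (rotate i b) \<inter> accessed K L (node K (v + offset L b j)) \<noteq> {}"
proof (cases "i < j")
  case True
  then show ?thesis
    using gap_set_rotate_later[OF True assms(2), of K v L] \<open>L > 0\<close>
      node_in_accessed[of "v + offset L b j" "v + offset L b j" L K] by auto
next
  case False
  then have ji: "j < i"
    using assms(3) by simp
  show ?thesis
    using gap_set_rotate_earlier[OF ji assms(1,5), of v] \<open>L > 0\<close>
      node_in_accessed[of "v + offset L b j" "v + offset L b j + (L - 1)" L K] by auto
qed

text \<open>The \<open>L\<close> caches starting at such a \<open>z\<close> reach from at most
  \<open>offset L b j + L - 1\<close> to at least \<open>offset L b (Suc j)\<close>. One of these
  two nodes lies in the set, according to whether \<open>i\<close> exceeds \<open>j\<close>.\<close>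

lemma between_knows_all:
  assumes "i < length b" "Suc j < length b" "offset L b (length b) = K + (L - 1)"
    and "offset L b j + b ! j < z" "z < offset L b j + L"
  shows "gap_set K L (v + offset L b i) (rotate i b) \<inter> accessed K L (node K (v + z)) \<noteq> {}"
proof (cases "i < Suc j")
  case True
  have "node K (v + offset L b (Suc j)) \<in> accessed K L (node K (v + z))"
    using assms offset_Suc[of j b L] by (intro node_in_accessed) auto
  then show ?thesis
    using gap_set_rotate_later[OF True assms(2)] by blast
next
  case False
  then have ji: "j < i" by simp
  have "node K (v + offset L b j + (L - 1)) \<in> accessed K L (node K (v + z))"
    using assms by (intro node_in_accessed) auto
  then show ?thesis
    using gap_set_rotate_earlier[OF ji assms(1,3)] by blast
qed

section \<open>Counting the sums that a user does not know\<close>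

lemma offset_segment:
  assumes "t \<le> length b" "z < offset L b t"
  shows "\<exists>j<t. offset L b j \<le> z \<and> z < offset L b (Suc j)"
  using assms
proof (induction t)
  case 0
  then show ?case by (simp add: offset_def)
next
  case (Suc t)
  then show ?case
    by (cases "z < offset L b t") (auto intro: less_SucI)
qed

text \<open>Each of the first \<open>w\<close> segments has at most \<open>2 * b ! j + 1\<close> bad
  positions: its first \<open>b ! j + 1\<close> and its last \<open>b ! j\<close>. The cycle closes
  within the final segment, leaving only \<open>b ! w + 1\<close> positions there. The saving of
  \<open>b ! w\<close> is why the maximum is rotated to the end.\<close>

lemma card_ignorant_offsets:
  assumes len: "length b = Suc w" and total: "offset L b (Suc w) = K + (L - 1)" and "L > 0"
  shows "card {z. z < K \<and> \<not> (\<exists>j<w. offset L b j + b ! j < z \<and> z < offset L b j + L)}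
    \<le> 2 * sum_list b + w + 1 - b ! w" (is "card ?bad \<le> _")
proof -
  let ?seg = "\<lambda>j. {offset L b j..offset L b j + b ! j} \<union> {offset L b j + L..<offset L b j + L + b ! j}"
  have K: "K = offset L b w + b ! w + 1"
    using total offset_Suc[of w b L] len \<open>L > 0\<close> by simp
  have "?bad \<subseteq> (\<Union>j\<in>{..<w}. ?seg j) \<union> {offset L b w..<K}"
  proof
    fix z assume z: "z \<in> ?bad"
    show "z \<in> (\<Union>j\<in>{..<w}. ?seg j) \<union> {offset L b w..<K}"
    proof (cases "z < offset L b w")
      case True
      then obtain j where j: "j < w" "offset L b j \<le> z" "z < offset L b (Suc j)"
        using offset_segment[of w b z L] len by auto
      moreover have "\<not> (offset L b j + b ! j < z \<and> z < offset L b j + L)"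
        using z j(1) by blast
      ultimately have "z \<in> ?seg j"
        using offset_Suc[of j b L] len by auto
      then show ?thesis using j(1) by blast
    qed (use z in auto)
  qed
  then have "card ?bad \<le> card ((\<Union>j\<in>{..<w}. ?seg j) \<union> {offset L b w..<K})"
    by (intro card_mono) auto
  also have "\<dots> \<le> card (\<Union>j\<in>{..<w}. ?seg j) + card {offset L b w..<K}"
    by (rule card_Un_le)
  also have "card (\<Union>j\<in>{..<w}. ?seg j) \<le> (\<Sum>j\<in>{..<w}. card (?seg j))"
    by (rule card_UN_le) simp
  also have "\<dots> \<le> (\<Sum>j\<in>{..<w}. 2 * b ! j + 1)"
    by (rule sum_mono, rule order_trans[OF card_Un_le]) simp
  also have "\<dots> = 2 * (\<Sum>j<w. b ! j) + w"
    by (simp only: sum.distrib sum_distrib_left) simp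
  also have "card {offset L b w..<K} = b ! w + 1"
    by (simp add: K)
  finally have "card ?bad \<le> 2 * (\<Sum>j<w. b ! j) + w + (b ! w + 1)"
    by simp
  moreover have "sum_list b = (\<Sum>j<w. b ! j) + b ! w"
    by (simp add: sum_list_sum_nth len atLeast0LessThan)
  ultimately show ?thesis by simp
qed

text \<open>For a fixed user, the start \<open>v\<close> is determined by the forward distance
  \<open>z\<close> from \<open>v\<close> to the user, so the previous count of distances also bounds
  the number of starts.\<close>

lemma card_ignorant_starts:
  assumes len: "length b = Suc w" and total: "offset L b (Suc w) = K + (L - 1)" and "L > 0" and "x < K"
  shows "card {v. v < K \<and> (\<exists>i\<le>w. gap_set K L (v + offset L b i) (rotate i b)
           \<inter> accessed K L (node K x) = {})} \<le> min (2 * sum_list b + w + 1 - b ! w) K"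
    (is "card ?V \<le> _")
proof -
  let ?bad = "{z. z < K \<and> \<not> (\<exists>j<w. offset L b j + b ! j < z \<and> z < offset L b j + L)}"
  have "?V \<subseteq> (\<lambda>z. (x + K - z) mod K) ` ?bad"
  proof
    fix v assume v: "v \<in> ?V"
    define z where "z = (if v \<le> x then x - v else x + K - v)"
    have vz: "node K (v + z) = node K x"
      using v by (auto simp: z_def node_def)
    have "z < K"
      using v \<open>x < K\<close> by (auto simp: z_def)
    moreover have "\<not> (offset L b j + b ! j < z \<and> z < offset L b j + L)" if "j < w" for j
      using v between_knows_all[of _ b j L K z v] that len total unfolding vz by fastforce
    ultimately have "z \<in> ?bad" by blast
    moreover have "v = (x + K - z) mod K"
      using v by (auto simp: z_def)
    ultimately show "v \<in> (\<lambda>z. (x + K - z) mod K) ` ?bad" by blast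
  qed
  then have "card ?V \<le> card ((\<lambda>z. (x + K - z) mod K) ` ?bad)"
    by (intro card_mono) auto
  also have "\<dots> \<le> card ?bad"
    by (rule card_image_le) simp
  also have "\<dots> \<le> 2 * sum_list b + w + 1 - b ! w"
    using len total \<open>L > 0\<close> by (rule card_ignorant_offsets)
  finally have "card ?V \<le> 2 * sum_list b + w + 1 - b ! w" .
  moreover have "card ?V \<le> K"
    using card_mono[of "{..<K}" ?V] by auto
  ultimately show ?thesis by simp
qed

section \<open>Recovering the composition from a spread set\<close>

lemma spread_linear:
  assumes "finite O'" "card O' = w" "O' \<subseteq> {lo + L..hi}" "lo \<le> hi"
    and "\<And>p q. p \<in> O' \<Longrightarrow> q \<in> O' \<Longrightarrow> p < q \<Longrightarrow> p + L \<le> q"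
  shows "\<exists>b. length b = Suc w \<and> sum_list b + w * L = hi - lo \<and>
    O' = (\<lambda>t. lo + offset L b t) ` {1..w}"
  using assms
proof (induction w arbitrary: O' hi)
  case 0
  then show ?case by (intro exI[of _ "[hi - lo]"]) auto
next
  case (Suc w)
  \<comment> \<open>The largest point is split off: the others lie at most at \<open>p - L\<close>,
    which becomes the new right end, and \<open>hi - p\<close> is appended as the last gap.\<close>
  define p where "p = Max O'"
  have ne: "O' \<noteq> {}" using Suc.prems by auto
  have p: "p \<in> O'" "\<And>q. q \<in> O' \<Longrightarrow> q \<le> p"
    using Suc.prems(1) ne by (auto simp: p_def)
  have p_bounds: "lo + L \<le> p" "p \<le> hi"
    using p(1) Suc.prems(3) by auto
  have "O' - {p} \<subseteq> {lo + L..p - L}"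
  proof
    fix q assume q: "q \<in> O' - {p}"
    then have "q + L \<le> p"
      using p Suc.prems(5)[of q p] by force
    then show "q \<in> {lo + L..p - L}"
      using q Suc.prems(3) by auto
  qed
  then have "\<exists>b. length b = Suc w \<and> sum_list b + w * L = p - L - lo \<and>
      O' - {p} = (\<lambda>t. lo + offset L b t) ` {1..w}"
    using Suc.prems(1,2,5) p p_bounds by (intro Suc.IH) auto
  then obtain b where b: "length b = Suc w" "sum_list b + w * L = p - L - lo"
    "O' - {p} = (\<lambda>t. lo + offset L b t) ` {1..w}" by blast
  let ?b = "b @ [hi - p]"
  have "p = lo + offset L ?b (Suc w)"
    using b(1,2) p_bounds by (simp add: offset_def)
  moreover have "offset L ?b t = offset L b t" if "t \<in> {1..w}" for t
    using that b(1) by (simp add: offset_def)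
  ultimately have "(\<lambda>t. lo + offset L ?b t) ` {1..Suc w} = insert p (O' - {p})"
    unfolding b(3) by (auto simp: atLeastAtMostSuc_conv)
  then have "O' = (\<lambda>t. lo + offset L ?b t) ` {1..Suc w}"
    using p(1) by auto
  moreover have "sum_list ?b + Suc w * L = hi - lo"
    using b(2) p_bounds by simp
  ultimately show ?case
    using b(1) by (intro exI[of _ ?b]) simp
qed

lemma node_add: "x < K \<Longrightarrow> o' < K \<Longrightarrow> node K (x + o') = (if x + o' < K then x + o' + 1 else x + o' + 1 - K)"
  by (auto simp: node_def mod_if)

lemma gap_set_mod: "gap_set K L (y mod K) b = gap_set K L y b"
  by (simp add: gap_set_def node_mod)

lemma sum_list_rotate: "sum_list (rotate n b) = sum_list (b :: nat list)"
proof (induction n)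
  case (Suc n)
  have "sum_list (rotate1 c) = sum_list c" for c :: "nat list"
    by (cases c) auto
  then show ?case using Suc by simp
qed simp

lemma rotate_weak_compositions: "b \<in> weak_compositions m n \<Longrightarrow> rotate j b \<in> weak_compositions m n"
  by (simp add: weak_compositions_def sum_list_rotate)

text \<open>Rotating by one more than the position of the maximum moves it to index
  \<open>w\<close>.\<close>

lemma exists_rotation_Max_last:
  assumes "length b = Suc w"
  shows "\<exists>j. rotate j b ! w = Max (set b)"
proof -
  have "Max (set b) \<in> set b"
    using assms by (intro Max_in) auto
  then obtain i where i: "i < length b" "b ! i = Max (set b)"
    by (auto simp: in_set_conv_nth)
  have "Suc i + w = i + length b"
    using assms by simp
  then have "(Suc i + w) mod length b = i"
    using i(1) by (simp only: mod_add_self2 mod_less)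
  then show ?thesis
    using i assms by (intro exI[of _ "Suc i"]) (simp add: nth_rotate del: rotate_Suc)
qed

text \<open>The cycle is cut open at \<open>x\<close>. Missing the caches of the user keeps the set
  out of the first \<open>L\<close> distances, and cyclic spreading becomes linear spreading, so
  \<open>spread_linear\<close> yields the gaps.\<close>

lemma gap_set_exists:
  assumes "x < K" "L > 0" and s: "s \<in> spread_subsets K L w"
    and unknown: "s \<inter> accessed K L (node K x) = {}"
  obtains b where "b \<in> weak_compositions (w + 1) (int K - int w * int L - 1)" "gap_set K L x b = s"
proof -
  define f where "f = (\<lambda>z. node K (x + z))"
  define O' where "O' = {z. z < K \<and> f z \<in> s}"
  have f: "f z = (if x + z < K then x + z + 1 else x + z + 1 - K)" if "z < K" for z
    using that \<open>x < K\<close> by (simp add: f_def node_add)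
  have inj: "inj_on f {..<K}"
    using \<open>x < K\<close> by (auto simp: inj_on_def f split: if_splits)
  have s': "s \<subseteq> {1..K}" "card s = w"
    using s by (auto simp: spread_subsets_def)
  have "s \<subseteq> f ` O'"
  proof
    fix a assume a: "a \<in> s"
    define z where "z = (if a > x then a - 1 - x else a + K - 1 - x)"
    have "1 \<le> a" "a \<le> K"
      using a s'(1) by auto
    then have "z < K" "f z = a"
      using \<open>x < K\<close> by (auto simp: z_def f)
    then show "a \<in> f ` O'"
      using a by (auto simp: O'_def)
  qed
  then have s_eq: "s = f ` O'"
    by (auto simp: O'_def)
  have "card O' = w"
    using s'(2) inj unfolding s_eq by (subst (asm) card_image) (auto simp: O'_def inj_on_def)
  moreover have "O' \<subseteq> {0 + L..K - 1}"
  proof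
    fix z assume z: "z \<in> O'"
    have "\<not> z < L"
    proof
      assume "z < L"
      then have "f z \<in> accessed K L (node K x)"
        unfolding f_def by (intro node_in_accessed) auto
      then show False
        using z unknown by (auto simp: O'_def)
    qed
    then show "z \<in> {0 + L..K - 1}"
      using z by (auto simp: O'_def)
  qed
  moreover have "p + L \<le> p'" if p: "p \<in> O'" "p' \<in> O'" "p < p'" for p p'
  proof -
    have pK: "p < K" "p' < K"
      using p by (auto simp: O'_def)
    have "f p \<noteq> f p'"
      using inj p(3) pK by (auto simp: inj_on_def)
    moreover have "f p \<in> s" "f p' \<in> s"
      using p by (auto simp: O'_def)
    ultimately have "int L \<le> \<bar>int (f p) - int (f p')\<bar> \<and> int L \<le> int K - \<bar>int (f p) - int (f p')\<bar>"
      using s by (auto simp: spread_subsets_def)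
    then show ?thesis
      using p(3) pK \<open>x < K\<close> by (auto simp: f split: if_splits)
  qed
  moreover have "finite O'"
    by (simp add: O'_def)
  ultimately obtain b where b: "length b = Suc w" "sum_list b + w * L = K - 1 - 0"
    "O' = (\<lambda>t. 0 + offset L b t) ` {1..w}"
    using spread_linear[of O' w 0 L "K - 1"] by blast
  have "int (sum_list b) + int w * int L = int K - 1"
    using b(2) \<open>x < K\<close> by (simp flip: of_nat_mult of_nat_add)
  then have "b \<in> weak_compositions (w + 1) (int K - int w * int L - 1)"
    using b(1) by (simp add: weak_compositions_def)
  moreover have "gap_set K L x b = s"
    unfolding gap_set_def s_eq b(3) using b(1)
    by (simp add: image_image f_def atLeastLessThanSuc_atLeastAtMost)
  ultimately show ?thesis
    using that by blast
qed

section \<open>Counting spread sets\<close>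

lemma spread_subsets_nonempty:
  assumes "w * L \<le> K" "L > 0"
  shows "spread_subsets K L w \<noteq> {}"
proof -
  \<comment> \<open>Steps of exactly \<open>L\<close> starting from node 1 fit because
    \<open>w * L \<le> K\<close>; the same bound leaves a distance of at least \<open>L\<close>
    across the wrap-around.\<close>
  let ?f = "\<lambda>t. t * L + 1"
  have dist: "int L \<le> \<bar>int (?f t) - int (?f t')\<bar> \<and> int L \<le> int K - \<bar>int (?f t) - int (?f t')\<bar>"
    if t: "t < t'" "t' < w" for t t'
  proof -
    obtain e where e: "t' = t + Suc e"
      using t(1) less_imp_Suc_add by auto
    have "(t + e + 2) * L \<le> K"
      using t(2) assms(1) e mult_le_mono1[of "t + e + 2" w L] by linarith
    then have "int ((t + e + 2) * L) \<le> int K"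
      by (simp only: of_nat_le_iff)
    moreover have "int (?f t') - int (?f t) = int L + int e * int L"
      by (simp add: e algebra_simps)
    moreover have "int ((t + e + 2) * L) = int (t * L) + int e * int L + 2 * int L"
      by (simp add: algebra_simps)
    moreover have "0 \<le> int e * int L" "0 \<le> int (t * L)"
      by simp_all
    ultimately show ?thesis by linarith
  qed
  have dist': "int L \<le> \<bar>int (?f t) - int (?f t')\<bar> \<and> int L \<le> int K - \<bar>int (?f t) - int (?f t')\<bar>"
    if "t \<noteq> t'" "t < w" "t' < w" for t t'
    using dist[of t t'] dist[of t' t] that by (cases "t < t'") (auto simp: abs_minus_commute)
  have "inj_on ?f {..<w}"
    using assms(2) by (auto simp: inj_on_def)
  then have "card (?f ` {..<w}) = w"
    by (simp add: card_image)
  moreover have "?f ` {..<w} \<subseteq> {1..K}"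
  proof
    fix a assume "a \<in> ?f ` {..<w}"
    then obtain t where t: "t < w" "a = t * L + 1" by auto
    have "Suc t * L \<le> w * L"
      using t(1) by (intro mult_le_mono1) simp
    then show "a \<in> {1..K}"
      using t(2) assms by auto
  qed
  moreover have "int L \<le> \<bar>int a - int a'\<bar> \<and> int L \<le> int K - \<bar>int a - int a'\<bar>"
    if a: "a \<in> ?f ` {..<w}" "a' \<in> ?f ` {..<w}" "a \<noteq> a'" for a a'
  proof -
    obtain t t' where "a = ?f t" "a' = ?f t'" "t < w" "t' < w"
      using a(1,2) by auto
    then show ?thesis
      using dist'[of t t'] a(3) by blast
  qed
  ultimately have "?f ` {..<w} \<in> spread_subsets K L w"
    unfolding spread_subsets_def by blast
  then show ?thesis by blast
qed

lemma finite_spread_subsets: "finite (spread_subsets K L w)"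
  by (rule finite_subset[of _ "Pow {1..K}"]) (auto simp: spread_subsets_def)

text \<open>The rotation \<open>\<sigma>\<close> carries \<open>k\<close> to \<open>k'\<close>. It
  either keeps a difference or replaces it by its complement to \<open>K\<close>, and the spreading
  condition is symmetric under this exchange.\<close>

lemma card_spread_subsets_containing_le:
  assumes k: "k \<in> {1..K}" "k' \<in> {1..K}"
  shows "card {s \<in> spread_subsets K L w. k \<in> s} \<le> card {s \<in> spread_subsets K L w. k' \<in> s}"
proof -
  define t where "t = (if k \<le> k' then k' - k else k' + K - k)"
  define \<sigma> where "\<sigma> = (\<lambda>a. if a + t \<le> K then a + t else a + t - K)"
  have t: "t < K"
    using k by (auto simp: t_def)
  have inj: "inj_on \<sigma> {1..K}"
    using t by (auto simp: inj_on_def \<sigma>_def split: if_splits)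
  have dist: "\<bar>int (\<sigma> a) - int (\<sigma> a')\<bar> = \<bar>int a - int a'\<bar> \<or>
      \<bar>int (\<sigma> a) - int (\<sigma> a')\<bar> = int K - \<bar>int a - int a'\<bar>"
    if "a \<in> {1..K}" "a' \<in> {1..K}" for a a'
    using that t by (auto simp: \<sigma>_def)
  have "\<sigma> ` s \<in> spread_subsets K L w" if s: "s \<in> spread_subsets K L w" for s
  proof -
    have sub: "s \<subseteq> {1..K}" and card: "card s = w"
      and spread: "\<And>a a'. a \<in> s \<Longrightarrow> a' \<in> s \<Longrightarrow> a \<noteq> a' \<Longrightarrow>
        int L \<le> \<bar>int a - int a'\<bar> \<and> int L \<le> int K - \<bar>int a - int a'\<bar>"
      using s by (auto simp: spread_subsets_def)
    have "int L \<le> \<bar>int (\<sigma> a) - int (\<sigma> a')\<bar> \<and> int L \<le> int K - \<bar>int (\<sigma> a) - int (\<sigma> a')\<bar>"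
      if "a \<in> s" "a' \<in> s" "\<sigma> a \<noteq> \<sigma> a'" for a a'
    proof -
      have "a \<noteq> a'" using that by blast
      then show ?thesis
        using dist[of a a'] spread[of a a'] that sub by (auto simp: subset_iff)
    qed
    moreover have "\<sigma> ` s \<subseteq> {1..K}"
      using sub t by (auto simp: \<sigma>_def subset_iff)
    moreover have "card (\<sigma> ` s) = w"
      using card card_image[OF inj_on_subset[OF inj sub]] by simp
    ultimately show ?thesis
      unfolding spread_subsets_def by blast
  qed
  moreover have "\<sigma> k = k'"
    using k by (auto simp: \<sigma>_def t_def)
  ultimately have "(`) \<sigma> ` {s \<in> spread_subsets K L w. k \<in> s} \<subseteq> {s \<in> spread_subsets K L w. k' \<in> s}"
    by blast
  moreover have "inj_on ((`) \<sigma>) {s \<in> spread_subsets K L w. k \<in> s}"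
    by (rule inj_on_subset[OF inj_on_image_Pow[OF inj]]) (auto simp: spread_subsets_def)
  ultimately show ?thesis
    using finite_spread_subsets by (intro card_inj_on_le) auto
qed

text \<open>Double counting of incidences between nodes and spread sets, all nodes being equivalent
  under rotation. It shows that a cache stores at most the fraction \<open>w / K\<close> of each
  file.\<close>

lemma card_spread_subsets_containing:
  assumes "k \<in> {1..K}"
  shows "K * card {s \<in> spread_subsets K L w. k \<in> s} = w * card (spread_subsets K L w)"
proof -
  let ?S = "spread_subsets K L w"
  have "(\<Sum>a\<in>{1..K}. card {s \<in> ?S. a \<in> s}) = (\<Sum>a\<in>{1..K}. card {s \<in> ?S. k \<in> s})"
    using assms by (intro sum.cong refl antisym card_spread_subsets_containing_le)
  moreover have "(\<Sum>a\<in>{1..K}. card {s \<in> ?S. a \<in> s}) = (\<Sum>s\<in>?S. card {a \<in> {1..K}. a \<in> s})"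
    by (rule sum_multicount_gen) (auto simp: finite_spread_subsets)
  moreover have "card {a \<in> {1..K}. a \<in> s} = w" if "s \<in> ?S" for s
  proof -
    have "{a \<in> {1..K}. a \<in> s} = s"
      using that by (auto simp: spread_subsets_def)
    then show ?thesis
      using that by (simp add: spread_subsets_def)
  qed
  ultimately show ?thesis by simp
qed

section \<open>The scheme\<close>

text \<open>The sum over \<open>B\<close> is the cost of the coded parts, each of
  \<open>F div P\<close> bits. The term \<open>K * P\<close> covers the at most \<open>P\<close>
  leftover bits of each requested file, which are not cached, and the final \<open>K\<close> is the
  price of colouring.\<close>

lemma new_scheme:
  fixes N K L w F :: nat
  defines "S \<equiv> spread_subsets K L w"
    and "B \<equiv> weak_compositions (w + 1) (int K - int w * int L - 1)"
  defines "P \<equiv> card S * (w + 1)"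
  assumes "K > 0" "L > 0" "w * L \<le> K"
  shows "\<exists>Z enc dec. uncoded_placement N K (real w * real N / real K) F Z \<and>
    delivery_scheme N K L F Z
      (\<lambda>_. (\<Sum>b\<in>B. min (2 * sum_list b + w + 1 - Max (set b)) K * (F div P)) + K * P + K) enc dec"
proof -
  define q where "q = F div P"
  define unk where "unk = (\<lambda>b. min (2 * sum_list b + w + 1 - Max (set b)) K)"
  have finS: "finite S"
    by (simp add: S_def finite_spread_subsets)
  have "P > 0"
    using spread_subsets_nonempty[of w L K] finS assms by (simp add: P_def S_def card_gt_0_iff)
  have PqF: "P * q \<le> F" "F - P * q \<le> P"
    using \<open>P > 0\<close> mod_less_divisor[of P F] by (simp_all add: q_def minus_mult_div_eq_mod less_imp_le)
  have "card (S \<times> {..w} \<times> {..<q}) = card {..<P * q}"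
    by (simp add: P_def card_cartesian_product algebra_simps)
  \<comment> \<open>A bit with label \<open>(s, r, l)\<close> is bit \<open>l\<close> of the part of
    its file with set \<open>s\<close> and index \<open>r\<close>.\<close>
  then obtain lab where lab: "bij_betw lab {..<P * q} (S \<times> {..w} \<times> {..<q})"
    using finS by (metis finite_same_card_bij finite_lessThan finite_SigmaI finite_atMost)
  define Z where "Z = (\<lambda>k. {1..N} \<times> {i. i < P * q \<and> k \<in> fst (lab i)})"
  define C where "C k = \<Union> (Z ` accessed K L k)" for k

  have placement: "uncoded_placement N K (real w * real N / real K) F Z"
    unfolding uncoded_placement_def
  proof (intro ballI conjI)
    fix k assume k: "k \<in> {1..K}"
    show "Z k \<subseteq> {1..N} \<times> {..<F}"
      using PqF by (auto simp: Z_def)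
    have "lab ` {i. i < P * q \<and> k \<in> fst (lab i)} = {y \<in> lab ` {..<P * q}. k \<in> fst y}"
      by auto
    moreover have "inj_on lab {i. i < P * q \<and> k \<in> fst (lab i)}"
      using lab by (auto simp: bij_betw_def intro: inj_on_subset)
    ultimately have "bij_betw lab {i. i < P * q \<and> k \<in> fst (lab i)} {y \<in> S \<times> {..w} \<times> {..<q}. k \<in> fst y}"
      using lab by (simp add: bij_betw_def)
    moreover have "{y \<in> S \<times> {..w} \<times> {..<q}. k \<in> fst y} = {s \<in> S. k \<in> s} \<times> {..w} \<times> {..<q}"
      by auto
    ultimately have "card {i. i < P * q \<and> k \<in> fst (lab i)} = card {s \<in> S. k \<in> s} * ((w + 1) * q)"
      by (simp add: bij_betw_same_card card_cartesian_product)
    then have "card (Z k) * K = N * (K * card {s \<in> S. k \<in> s}) * ((w + 1) * q)"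
      by (simp add: Z_def card_cartesian_product)
    also have "\<dots> = w * N * (P * q)"
      unfolding S_def card_spread_subsets_containing[OF k] by (simp add: P_def S_def algebra_simps)
    also have "\<dots> \<le> w * N * F"
      using PqF by (intro mult_le_mono2)
    finally have "real (card (Z k)) * real K \<le> real w * real N * real F"
      by (simp only: of_nat_mult[symmetric] of_nat_le_iff)
    then show "real (card (Z k)) \<le> real w * real N / real K * real F"
      using \<open>K > 0\<close> by (simp add: field_simps)
  qed

  have known: "(n, i) \<in> C k"
    if "n \<in> {1..N}" "i < P * q" "fst (lab i) \<inter> accessed K L k \<noteq> {}" for n i k
    using that by (auto simp: C_def Z_def)

  have B_length: "length b = Suc w" if "b \<in> B" for b
    using that by (simp add: B_def weak_compositions_def)
  have "\<exists>j. rotate j b ! w = Max (set b)" if "b \<in> B" for b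
    using exists_rotation_Max_last B_length[OF that] .
  then obtain rt where rt: "\<And>b. b \<in> B \<Longrightarrow> rotate (rt b) b ! w = Max (set b)"
    by metis
  define c where "c = (\<lambda>b. rotate (rt b) b)"
  have c_length: "length (c b) = Suc w" if "b \<in> B" for b
    using B_length[OF that] by (simp add: c_def)
  have c_total: "offset L (c b) (Suc w) = K + (L - 1)" if "b \<in> B" for b
  proof -
    have "int (sum_list b) = int K - int w * int L - 1"
      using that by (simp add: B_def weak_compositions_def)
    then have "int (sum_list b + w * L + 1) = int K"
      by simp
    then have "sum_list b + w * L + 1 = K"
      by (simp only: of_nat_eq_iff)
    then show ?thesis
      using c_length[OF that] \<open>L > 0\<close> by (simp add: offset_def c_def sum_list_rotate)
  qed

  define rcv where "rcv = (\<lambda>b v t. node K (v + offset L (c b) t))"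
  define missing where "missing = (\<lambda>b v t. gap_set K L (v + offset L (c b) t) (rotate t (c b)))"
  \<comment> \<open>The part index counts rotations from \<open>b\<close> itself and not from
    \<open>c b\<close>. Otherwise compositions with the same \<open>c b\<close> would deliver the
    same parts repeatedly, and other parts would never be sent.\<close>
  define X where "X = (\<lambda>(d :: nat \<Rightarrow> nat) b v l. {(d (rcv b v t), i) | t i. t \<le> w \<and> i < P * q \<and>
    lab i = (missing b v t, (t + rt b) mod (w + 1), l)})"
  define XA where "XA = (\<lambda>d. (\<lambda>(b, v, l). X d b v l) ` (B \<times> {..<K} \<times> {..<q}))"
  \<comment> \<open>Leftover bits are sent as singletons, that is, uncoded.\<close>
  define XR where "XR = (\<lambda>d :: nat \<Rightarrow> nat. (\<lambda>(k, i). {(d k, i)}) ` ({1..K} \<times> {P * q..<F}))"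
  have rcv_range: "rcv b v t \<in> {1..K}" for b v t
    using mod_less_divisor[OF \<open>K > 0\<close>, of "v + offset L (c b) t"] by (simp add: rcv_def node_def Suc_le_eq)
  have finB: "finite B"
    by (simp add: B_def finite_weak_compositions)

  have "\<exists>enc dec. delivery_scheme N K L F Z (\<lambda>_. ((\<Sum>b\<in>B. unk b * q) + K * P) + K) enc dec"
  proof (rule delivery_scheme_parities[where K = K and L = L and Z = Z and A = "\<lambda>d. XA d \<union> XR d",
        folded C_def])
    fix d assume d: "d \<in> requests N K"
    have dN: "d k \<in> {1..N}" if "k \<in> {1..K}" for k
      using d that by (auto simp: requests_def)
    show "finite (XA d \<union> XR d)"
      using finB by (auto simp: XA_def XR_def)
    show "finite Y" if "Y \<in> XA d \<union> XR d" for Y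
    proof (rule finite_subset)
      show "Y \<subseteq> d ` {1..K} \<times> {..<F}"
        using that rcv_range PqF by (fastforce simp: XA_def XR_def X_def)
    qed simp
    fix k assume k: "k \<in> {1..K}"
    define x where "x = k - 1"
    have x: "x < K" "node K x = k"
      using k by (auto simp: x_def node_def)

    show "card {Y \<in> XA d \<union> XR d. \<not> Y \<subseteq> C k} \<le> (\<Sum>b\<in>B. unk b * q) + K * P"
    proof -
      define V where "V = (\<lambda>b. {v. v < K \<and> (\<exists>t\<le>w. missing b v t \<inter> accessed K L k = {})})"
      have finV: "finite (V b)" for b
        by (simp add: V_def)
      have card_V: "card (V b) \<le> unk b" if b: "b \<in> B" for b
        using card_ignorant_starts[OF c_length[OF b] c_total[OF b] \<open>L > 0\<close> x(1)] rt[OF b]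
        by (simp add: V_def missing_def unk_def x(2)) (simp add: c_def sum_list_rotate)
      let ?T = "(\<lambda>(b, v, l). X d b v l) ` (SIGMA b:B. V b \<times> {..<q})"
      have "X d b v l \<subseteq> C k" if "v < K" "v \<notin> V b" for b v l
        using that known dN[OF rcv_range] by (fastforce simp: X_def V_def)
      then have "{Y \<in> XA d \<union> XR d. \<not> Y \<subseteq> C k} \<subseteq> ?T \<union> XR d"
        unfolding XA_def by blast
      then have "card {Y \<in> XA d \<union> XR d. \<not> Y \<subseteq> C k} \<le> card (?T \<union> XR d)"
        using finB finV by (intro card_mono finite_UnI finite_imageI finite_SigmaI) (auto simp: XR_def)
      also have "\<dots> \<le> card ?T + card (XR d)"
        by (rule card_Un_le)
      also have "card ?T \<le> card (SIGMA b:B. V b \<times> {..<q})"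
        using finB finV by (intro card_image_le finite_SigmaI) auto
      also have "\<dots> = (\<Sum>b\<in>B. card (V b) * q)"
        using finB finV by (subst card_SigmaI) (auto simp: card_cartesian_product)
      also have "\<dots> \<le> (\<Sum>b\<in>B. unk b * q)"
        using card_V by (intro sum_mono mult_le_mono1)
      also have "card (XR d) \<le> card ({1..K} \<times> {P * q..<F})"
        unfolding XR_def by (rule card_image_le) simp
      also have "\<dots> \<le> K * P"
        using PqF by (simp add: card_cartesian_product)
      finally show ?thesis by simp
    qed

    fix i assume i: "i < F" and unknown: "(d k, i) \<notin> C k"
    show "\<exists>Y\<in>XA d \<union> XR d. (d k, i) \<in> Y \<and> Y - {(d k, i)} \<subseteq> C k"
    proof (cases "i < P * q")
      case False
      then show ?thesis
        using i k by (intro bexI[of _ "{(d k, i)}"]) (auto simp: XR_def)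
    next
      case True
      then have "lab i \<in> S \<times> {..w} \<times> {..<q}"
        using lab by (auto simp: bij_betw_def)
      then obtain s r l where lab_i: "lab i = (s, r, l)" and srl: "s \<in> S" "r \<le> w" "l < q"
        by auto
      have "s \<inter> accessed K L (node K x) = {}"
        using known[OF dN[OF k] True, of k] unknown by (auto simp: lab_i x(2))
      then obtain b' where b': "b' \<in> B" "gap_set K L x b' = s"
        using gap_set_exists[OF x(1) \<open>L > 0\<close>] srl(1) unfolding S_def B_def by metis
      \<comment> \<open>Undoing \<open>r\<close> of the cyclic shifts gives the composition whose
        sum carries part index \<open>r\<close> for the gaps \<open>b'\<close>.\<close>
      define b where "b = rotate (w + 1 - r) b'"
      have b: "b \<in> B"
        using b'(1) by (simp add: b_def B_def rotate_weak_compositions)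
      \<comment> \<open>Since \<open>w\<close> is -1 modulo \<open>w + 1\<close>, this solves
        \<open>t + rt b = r\<close> modulo \<open>w + 1\<close> without subtraction.\<close>
      define t where "t = (r + rt b * w) mod (w + 1)"
      have t: "t \<le> w"
        by (simp add: t_def flip: less_Suc_eq_le)
      have "(t + rt b) mod (w + 1) = (r + rt b * (w + 1)) mod (w + 1)"
        by (simp add: t_def mod_simps algebra_simps)
      also have "\<dots> = r"
        using srl(2) by (simp only: mod_mult_self1) simp
      finally have tr: "(t + rt b) mod (w + 1) = r" .
      have "rotate t (c b) = rotate ((t + rt b) mod (w + 1)) b"
        using B_length[OF b] by (simp add: c_def rotate_rotate rotate_conv_mod[of "t + rt b" b])
      also have "\<dots> = rotate (r + (w + 1 - r)) b'"
        by (simp only: tr) (simp only: b_def rotate_rotate)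
      also have "r + (w + 1 - r) = length b'"
        using srl(2) B_length[OF b'(1)] by simp
      also have "rotate (length b') b' = b'"
        by simp
      finally have rot_t: "rotate t (c b) = b'" .
      \<comment> \<open>Likewise \<open>K - 1\<close> acts as -1 modulo \<open>K\<close>, so
        \<open>v\<close> is the start from which the receiver at index \<open>t\<close> is
        \<open>k\<close>.\<close>
      define v where "v = (x + offset L (c b) t * (K - 1)) mod K"
      have "offset L (c b) t * (K - 1) + offset L (c b) t = offset L (c b) t * K"
        using \<open>K > 0\<close> by (cases K) auto
      then have "(v + offset L (c b) t) mod K = (x + offset L (c b) t * K) mod K"
        by (simp add: v_def mod_simps add.assoc)
      then have v: "v < K" "(v + offset L (c b) t) mod K = x"
        using x(1) \<open>K > 0\<close> by (simp_all add: v_def)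
      have rcv_t: "rcv b v t = k"
        using v(2) x by (simp add: rcv_def node_def)
      have missing_t: "missing b v t = s"
        using gap_set_mod[of K L "v + offset L (c b) t" b'] v(2) b'(2) by (simp add: missing_def rot_t)
      have "(d k, i) \<in> X d b v l"
        unfolding X_def using t True rcv_t missing_t tr lab_i by force
      moreover have "X d b v l - {(d k, i)} \<subseteq> C k"
      proof
        fix y assume y: "y \<in> X d b v l - {(d k, i)}"
        then obtain t' i' where y_eq: "y = (d (rcv b v t'), i')" and t': "t' \<le> w" "i' < P * q"
          and lab_i': "lab i' = (missing b v t', (t' + rt b) mod (w + 1), l)"
          by (auto simp: X_def)
        have "t' \<noteq> t"
        proof
          assume "t' = t"
          then have "lab i' = lab i"
            using lab_i lab_i' missing_t tr by simp
          then have "i' = i"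
            using lab t'(2) True by (auto simp: bij_betw_def inj_on_def)
          then show False
            using y y_eq \<open>t' = t\<close> rcv_t by simp
        qed
        then have "missing b v t' \<inter> accessed K L k \<noteq> {}"
          using receiver_knows_others[of t' "c b" t L K v] t t' c_length[OF b] c_total[OF b] \<open>L > 0\<close> rcv_t
          by (simp add: missing_def rcv_def)
        then show "y \<in> C k"
          using known[OF dN[OF rcv_range] t'(2)] lab_i' by (simp add: y_eq)
      qed
      ultimately show ?thesis
        using b v(1) srl(3) by (intro bexI[of _ "X d b v l"]) (auto simp: XA_def)
    qed
  qed
  then show ?thesis
    using placement unfolding unk_def q_def by blast
qed

section \<open>Absorbing the overhead into the infimum\<close>

theorem theorem6:
  fixes N K L w :: nat
  assumes "N > 0" and "K > 0" and "L > 0" and "L \<le> K"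
    and "w \<in> {1..K div L}"
  shows "opt_rate N K L (real w * real N / real K) \<le> R_new K L w"
proof (rule field_le_epsilon)
  fix e :: real assume e: "e > 0"
  define B where "B = weak_compositions (w + 1) (int K - int w * int L - 1)"
  define P where "P = card (spread_subsets K L w) * (w + 1)"
  define m where "m = (\<Sum>b\<in>B. min (2 * sum_list b + w + 1 - Max (set b)) K)"
  have wL: "w * L \<le> K"
    using assms(3,5) by (simp add: less_eq_div_iff_mult_less_eq)
  have "P > 0"
    using spread_subsets_nonempty[OF wL \<open>L > 0\<close>] finite_spread_subsets[of K L w]
    by (simp add: P_def card_gt_0_iff)
  have R: "R_new K L w = real m / real P"
  proof -
    have "real (min (2 * sum_list b + w + 1 - Max (set b)) K) =
        min (2 * (real K - real w * real L) + real w - 1 - real (Max (set b))) (real K)"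
      if b: "b \<in> B" for b
    proof -
      have "int (sum_list b) = int K - int w * int L - 1" "length b = w + 1"
        using b by (auto simp: B_def weak_compositions_def)
      then have "real (sum_list b) = real K - real w * real L - 1"
        by (metis of_int_of_nat_eq of_int_diff of_int_mult of_int_1)
      \<comment> \<open>This bound ensures that the natural-number subtraction in \<open>m\<close>
        does not truncate.\<close>
      moreover have "Max (set b) \<in> set b"
        using \<open>length b = w + 1\<close> by (intro Max_in) auto
      then have "Max (set b) \<le> sum_list b"
        by (rule member_le_sum_list) simp
      ultimately show ?thesis
        by (simp add: of_nat_diff of_nat_min)
    qed
    then show ?thesis
      unfolding R_new_def m_def P_def B_def[symmetric] by (simp add: distrib_left)
  qed
  \<comment> \<open>From this file size on, the constant overhead \<open>K * P + K\<close>
    contributes at most \<open>e\<close> to the rate.\<close>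
  define F0 where "F0 = Suc (nat \<lceil>real (K * P + K) / e\<rceil>)"
  have "achievable N K L (real w * real N / real K) (R_new K L w + e)"
    unfolding achievable_def
  proof (intro exI[of _ F0] conjI allI impI)
    show "F0 > 0"
      by (simp add: F0_def)
    fix F assume F: "F \<ge> F0"
    let ?len = "\<lambda>_ :: nat \<Rightarrow> nat. (\<Sum>b\<in>B. min (2 * sum_list b + w + 1 - Max (set b)) K * (F div P)) + K * P + K"
    have "F > 0"
      using F by (simp add: F0_def)
    obtain Z enc dec where scheme: "uncoded_placement N K (real w * real N / real K) F Z"
      "delivery_scheme N K L F Z ?len enc dec"
      using new_scheme[OF \<open>K > 0\<close> \<open>L > 0\<close> wL, of N F] unfolding B_def P_def by blast
    have "real (m * (F div P)) * real P = real m * real (F div P * P)"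
      by simp
    also have "\<dots> \<le> real m * real F"
      by (intro mult_left_mono) (simp_all only: of_nat_le_iff div_times_less_eq_dividend of_nat_0_le_iff)
    finally have "real (m * (F div P)) / real F \<le> real m / real P"
      using \<open>P > 0\<close> \<open>F > 0\<close> by (simp add: divide_simps)
    moreover have "real (K * P + K) / e \<le> real F"
      using F unfolding F0_def by linarith
    then have "real (K * P + K) / real F \<le> e"
      using e \<open>F > 0\<close> by (simp add: divide_simps mult.commute)
    ultimately have "real (m * (F div P) + K * P + K) / real F \<le> R_new K L w + e"
      by (simp add: R add_divide_distrib)
    moreover have "worst_case_rate N K F ?len = real (m * (F div P) + K * P + K) / real F"
      using requests_nonempty[OF \<open>N > 0\<close>, of K]
      by (simp add: worst_case_rate_def image_constant_conv m_def sum_distrib_right)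
    ultimately have "worst_case_rate N K F ?len \<le> R_new K L w + e"
      by simp
    then show "\<exists>Z len enc dec. uncoded_placement N K (real w * real N / real K) F Z \<and>
        delivery_scheme N K L F Z len enc dec \<and> worst_case_rate N K F len \<le> R_new K L w + e"
      using scheme by blast
  qed
  then show "opt_rate N K L (real w * real N / real K) \<le> R_new K L w + e"
    unfolding opt_rate_def using bdd_below_achievable[OF \<open>N > 0\<close>] by (intro cInf_lower) auto
qed

end
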